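(* Let $w:\mathbb{Q}\cap(0,1)\to\mathbb{R}_{\ge 0}$ be a nontrivial weight function and let $R^w$ be a scoring rule parameterized by $w$. Suppose that $R^w$ is FVR-optimal, i.e., $\mathrm{FVR}(R^w,s)=1-s$ for all $s\in(0,1)$. Then there exists a positive real number $c$ such that $w(f)=\frac{c}{1-f}$ for all $f\in\mathbb{Q}\cap(0,1)$.
   Context: An (approval) instance consists of a finite non-empty set $N$ of $n$ voters, a finite non-empty set $M$ of $m$ candidates, and an approval set $A_i\subseteq M$ for each voter $i\in N$. For a candidate $a$, $N_a=\{i\in N\mid a\in A_i\}$ is the set of voters approving $a$. A single-winner rule $R$ selects, for every instance (for all $n$ and $m$), a single candidate in $M$. For a voter $i$, let $f_i=|A_i|/m$; for $s\in(0,1)$, voter $i$ is $s$-flexible if $f_i\ge s$. For a rule $R$ and $s\in(0,1)$, $\mathrm{FVR}(R,s)$ is the smallest $r\in[0,1]$ such that for every instance (over all $n$, $m$ and all approval sets), whenever a group of strictly more than $rn$ voters are all $s$-flexible, at least one voter in the group approves the candidate chosen by $R$ on that instance. (This minimum always exists.) A weight function is a function $w:\mathbb{Q}\cap(0,1)\to\mathbb{R}_{\ge0}$, with the convention $w(1)=0$; it is nontrivial if $w(f)>0$ for some $f\in\mathbb{Q}\cap(0,1)$. The $w$-score of a candidate $a$ is $\sum_{i\in N_a}w(f_i)$. A rule is parameterized by $w$ if on every instance it picks a candidate maximizing the $w$-score (with arbitrary tie-breaking); $R^w$ denotes any such rule. *)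

theory Defs
  imports Complex_Main "HOL-Library.FuncSet" "HOL-Library.Infinite_Typeclass"
begin

(* An instance is a triple (N, M, A) of voters, candidates and approval sets.  Labels are drawn
   from arbitrary infinite types, so that all numbers of voters and candidates occur.  The
   approval function is extensional, so each instance has exactly one representation and a
   rule (a HOL function of N, M and A) cannot depend on values of A outside N. *)
definition approval_instance :: "'v set \<Rightarrow> 'c set \<Rightarrow> ('v \<Rightarrow> 'c set) \<Rightarrow> bool" where
  "approval_instance N M A \<longleftrightarrow>
     finite N \<and> N \<noteq> {} \<and> finite M \<and> M \<noteq> {} \<and> A \<in> N \<rightarrow>\<^sub>E Pow M"

definition approvers :: "'v set \<Rightarrow> ('v \<Rightarrow> 'c set) \<Rightarrow> 'c \<Rightarrow> 'v set" where
  "approvers N A a = {i \<in> N. a \<in> A i}"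

definition flexibility :: "'c set \<Rightarrow> ('v \<Rightarrow> 'c set) \<Rightarrow> 'v \<Rightarrow> rat" where
  "flexibility M A i = of_nat (card (A i)) / of_nat (card M)"

definition flexible :: "real \<Rightarrow> 'c set \<Rightarrow> ('v \<Rightarrow> 'c set) \<Rightarrow> 'v \<Rightarrow> bool" where
  "flexible s M A i \<longleftrightarrow> real_of_rat (flexibility M A i) \<ge> s"

type_synonym ('v, 'c) rule = "'v set \<Rightarrow> 'c set \<Rightarrow> ('v \<Rightarrow> 'c set) \<Rightarrow> 'c"

definition single_winner_rule :: "('v::infinite, 'c::infinite) rule \<Rightarrow> bool" where
  "single_winner_rule R \<longleftrightarrow> (\<forall>N M A. approval_instance N M A \<longrightarrow> R N M A \<in> M)"

definition FVR_bound :: "('v::infinite, 'c::infinite) rule \<Rightarrow> real \<Rightarrow> real \<Rightarrow> bool" where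
  "FVR_bound R s r \<longleftrightarrow>
     (\<forall>N M A G. approval_instance N M A \<longrightarrow> G \<subseteq> N \<longrightarrow> real (card G) > r * real (card N) \<longrightarrow>
        (\<forall>i\<in>G. flexible s M A i) \<longrightarrow> (\<exists>i\<in>G. R N M A \<in> A i))"

definition FVR :: "('v::infinite, 'c::infinite) rule \<Rightarrow> real \<Rightarrow> real" where
  "FVR R s = (LEAST r. r \<in> {0..1} \<and> FVR_bound R s r)"

lemma FVR_is_minimum:
  fixes R :: "('v::infinite, 'c::infinite) rule"
  shows "FVR R s \<in> {0..1}" and "FVR_bound R s (FVR R s)"
    and "\<And>r. r \<in> {0..1} \<Longrightarrow> FVR_bound R s r \<Longrightarrow> FVR R s \<le> r"
proof -
  let ?P = "\<lambda>r. r \<in> {0..1} \<and> FVR_bound R s r"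
  define x where "x = Inf {r. ?P r}"
  have one: "?P 1"
    using card_mono unfolding FVR_bound_def approval_instance_def
    by (fastforce simp: not_less[symmetric])
  have bdd: "bdd_below {r. ?P r}"
    by (rule bdd_belowI[of _ 0]) auto
  have le: "x \<le> r" if "?P r" for r
    unfolding x_def using that by (intro cInf_lower bdd) auto
  have "0 \<le> x"
    unfolding x_def using one by (intro cInf_greatest) auto
  moreover have "x \<le> 1"
    using le one by blast
  moreover have "FVR_bound R s x"
    unfolding FVR_bound_def
  proof (intro allI impI)
    fix N :: "'v set" and M :: "'c set" and A G
    assume inst: "approval_instance N M A" and G: "G \<subseteq> N" "\<forall>i\<in>G. flexible s M A i"
      and gt: "real (card G) > x * real (card N)"
    have n: "real (card N) > 0"
      using inst by (auto simp: approval_instance_def card_gt_0_iff)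
    have "x < real (card G) / real (card N)"
      using gt n by (simp add: field_simps)
    then obtain r where r: "?P r" "r < real (card G) / real (card N)"
      unfolding x_def using cInf_lessD[of "{r. ?P r}"] one by blast
    have "real (card G) > r * real (card N)"
      using r(2) n by (simp add: field_simps)
    then show "\<exists>i\<in>G. R N M A \<in> A i"
      using r(1) inst G unfolding FVR_bound_def by blast
  qed
  ultimately have x: "?P x"
    by simp
  have "FVR R s = x"
    unfolding FVR_def by (rule Least_equality) (use x le in auto)
  then show "FVR R s \<in> {0..1}" "FVR_bound R s (FVR R s)"
    "\<And>r. r \<in> {0..1} \<Longrightarrow> FVR_bound R s r \<Longrightarrow> FVR R s \<le> r"
    using x le by auto
qed

definition FVR_optimal :: "('v::infinite, 'c::infinite) rule \<Rightarrow> bool" where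
  "FVR_optimal R \<longleftrightarrow> (\<forall>s\<in>{0<..<1}. FVR R s = 1 - s)"

(* Weights outside (0,1] are unconstrained but never used: a voter contributing to a score
   approves some candidate, so the flexibility lies in (0,1]. *)
definition weight_function :: "(rat \<Rightarrow> real) \<Rightarrow> bool" where
  "weight_function w \<longleftrightarrow> (\<forall>f\<in>{0<..<1}. w f \<ge> 0) \<and> w 1 = 0"

definition nontrivial_weight :: "(rat \<Rightarrow> real) \<Rightarrow> bool" where
  "nontrivial_weight w \<longleftrightarrow> (\<exists>f\<in>{0<..<1}. w f > 0)"

definition weight_score ::
  "(rat \<Rightarrow> real) \<Rightarrow> 'v set \<Rightarrow> 'c set \<Rightarrow> ('v \<Rightarrow> 'c set) \<Rightarrow> 'c \<Rightarrow> real" where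
  "weight_score w N M A a = (\<Sum>i\<in>approvers N A a. w (flexibility M A i))"

definition parameterized_by ::
  "('v::infinite, 'c::infinite) rule \<Rightarrow> (rat \<Rightarrow> real) \<Rightarrow> bool" where
  "parameterized_by R w \<longleftrightarrow>
     single_winner_rule R \<and>
     (\<forall>N M A. approval_instance N M A \<longrightarrow>
        (\<forall>a\<in>M. weight_score w N M A a \<le> weight_score w N M A (R N M A)))"

end

theory Submission imports Defs begin

text \<open>Let \<open>u f = (1 - f) * w f\<close>; we show \<open>u g \<le> u f\<close> for all \<open>f\<close>, \<open>g\<close>, so that \<open>u\<close> is constant.
  Fix a candidate \<open>x\<close>. A share \<open>t\<close> of the voters have flexibility \<open>f\<close> and reject \<open>x\<close>; the others
  have flexibility \<open>g\<close> and approve \<open>x\<close>; both groups spread their remaining approvals evenly over the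
  other candidates. Then \<open>x\<close> is the unique score maximizer as soon as
  \<open>(1 - t) * u g > t * f * w f\<close>, and in that case optimality at \<open>s = f\<close> forces \<open>t \<le> 1 - f\<close>.
  Letting \<open>t\<close> decrease to \<open>1 - f\<close> gives \<open>f * u g \<le> f * u f\<close>.\<close>

text \<open>Sliding the window by one step trades \<open>s\<close> for \<open>s + k\<close>, which
  has the same residue mod \<open>k\<close>; so the count is that of the window starting at
  0.\<close>

lemma card_window_mod_less:
  fixes s k p :: nat
  assumes "p \<le> k"
  shows "card {i \<in> {s..<s + k}. i mod k < p} = p"
proof (induction s)
  case 0
  have "{i \<in> {0..<0 + k}. i mod k < p} = {..<p}"
    using assms by auto
  then show ?case by simp
next
  case (Suc s)
  show ?case
  proof (cases "k = 0")
    case True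
    then show ?thesis using assms by simp
  next
    case False
    let ?W = "\<lambda>s. {i \<in> {s..<s + k}. i mod k < p}"
    let ?C = "{i \<in> {Suc s..<s + k}. i mod k < p}"
    have "{s..<s + k} = insert s {Suc s..<s + k}" "{Suc s..<Suc s + k} = insert (s + k) {Suc s..<s + k}"
      using False by auto
    then have "?W s = (if s mod k < p then insert s ?C else ?C)"
      "?W (Suc s) = (if s mod k < p then insert (s + k) ?C else ?C)"
      by auto
    then have "card (?W s) = card (?W (Suc s))"
      by simp
    then show ?thesis using Suc by simp
  qed
qed

lemma card_windows_mod_less:
  fixes s k p a :: nat
  assumes "p \<le> k"
  shows "card {i \<in> {s..<s + k * a}. i mod k < p} = a * p"
proof (induction a)
  case (Suc a)
  have "{i \<in> {s..<s + k * Suc a}. i mod k < p} =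
      {i \<in> {s..<s + k * a}. i mod k < p} \<union> {i \<in> {s + k * a..<s + k * a + k}. i mod k < p}"
    by auto
  then have "card {i \<in> {s..<s + k * Suc a}. i mod k < p} =
      card ({i \<in> {s..<s + k * a}. i mod k < p} \<union> {i \<in> {s + k * a..<s + k * a + k}. i mod k < p})"
    by simp
  also have "\<dots> = card {i \<in> {s..<s + k * a}. i mod k < p}
      + card {i \<in> {s + k * a..<s + k * a + k}. i mod k < p}"
    by (rule card_Un_disjoint) auto
  finally show ?case
    using Suc card_window_mod_less[OF assms] by simp
qed simp

text \<open>The pattern \<open>(i + c) mod k < p\<close> is symmetric in voter and candidate. This
  one count therefore gives both the size of an approval set (voter fixed, \<open>a = 1\<close>) and
  the number of approvers of a candidate (candidate fixed).\<close>

lemma card_shifted_windows_mod_less: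
  fixes c s k p a :: nat
  assumes "p \<le> k"
  shows "card {i \<in> {s..<s + k * a}. (c + i) mod k < p} = a * p"
proof -
  have "(+) c ` {i \<in> {s..<s + k * a}. (c + i) mod k < p} =
      {i \<in> {c + s..<c + s + k * a}. i mod k < p}"
  proof (intro equalityI subsetI)
    fix i assume i: "i \<in> {i \<in> {c + s..<c + s + k * a}. i mod k < p}"
    then have "i = c + (i - c)" by auto
    moreover have "i - c \<in> {i \<in> {s..<s + k * a}. (c + i) mod k < p}" using i by auto
    ultimately show "i \<in> (+) c ` {i \<in> {s..<s + k * a}. (c + i) mod k < p}" by blast
  qed auto
  then have "card {i \<in> {s..<s + k * a}. (c + i) mod k < p} =
      card {i \<in> {c + s..<c + s + k * a}. i mod k < p}"
    by (metis (no_types, lifting) card_image inj_on_add)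
  then show ?thesis using card_windows_mod_less[OF assms] by simp
qed

text \<open>Voters and candidates named by naturals allow approval sets to be defined by modular
  arithmetic. Both infinite label types contain a copy of the naturals, and running \<open>R\<close>
  on the copied instance preserves flexibilities, scores and FVR bounds.\<close>

lemma rule_transport_nat:
  fixes R :: "('v::infinite, 'c::infinite) rule"
  assumes "parameterized_by R w"
  obtains R' :: "(nat, nat) rule"
  where "parameterized_by R' w" "\<And>s r. FVR_bound R s r \<Longrightarrow> FVR_bound R' s r"
proof -
  obtain e :: "nat \<Rightarrow> 'v" where e: "inj e"
    using infinite_countable_subset[OF infinite_UNIV] by blast
  obtain h :: "nat \<Rightarrow> 'c" where h: "inj h"
    using infinite_countable_subset[OF infinite_UNIV] by blast
  \<comment> \<open>The restriction to the image of \<open>N\<close> keeps the copied approval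
    function extensional, as an instance demands.\<close>
  define T where "T = (\<lambda>N (A :: nat \<Rightarrow> nat set). \<lambda>v\<in>e ` N. h ` A (inv e v))"
  define R' where "R' = (\<lambda>N M A. inv h (R (e ` N) (h ` M) (T N A)))"
  have T_e: "T N A (e i) = h ` A i" if "i \<in> N" for N A i
    using that e by (simp add: T_def)
  have inst: "approval_instance (e ` N) (h ` M) (T N A)" if "approval_instance N M A" for N M A
    using that e unfolding approval_instance_def T_def by (fastforce simp: PiE_iff)
  have flex: "flexibility (h ` M) (T N A) (e i) = flexibility M A i" if "i \<in> N" for N M A i
    using that h by (simp add: flexibility_def T_e card_image inj_on_subset[OF h])
  have appr: "approvers (e ` N) (T N A) (h c) = e ` approvers N A c" for N A c
    using h by (auto simp: approvers_def T_e inj_image_mem_iff)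
  have score: "weight_score w (e ` N) (h ` M) (T N A) (h c) = weight_score w N M A c" for N M A c
    unfolding weight_score_def appr
    by (subst sum.reindex) (auto simp: flex approvers_def inj_on_subset[OF e] intro!: sum.cong)
  have R_in: "R (e ` N) (h ` M) (T N A) \<in> h ` M" if "approval_instance N M A" for N M A
    using assms inst[OF that] by (simp add: parameterized_by_def single_winner_rule_def)
  have h_R': "h (R' N M A) = R (e ` N) (h ` M) (T N A)" if "approval_instance N M A" for N M A
    using R_in[OF that] unfolding R'_def by (auto intro: f_inv_into_f)
  have "parameterized_by R' w"
    unfolding parameterized_by_def single_winner_rule_def
  proof (intro conjI allI impI ballI)
    fix N M :: "nat set" and A assume I: "approval_instance N M A"
    show "R' N M A \<in> M"
      using R_in[OF I] h by (auto simp: h_R'[OF I, symmetric] inj_image_mem_iff)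
    fix c assume "c \<in> M"
    then have "weight_score w (e ` N) (h ` M) (T N A) (h c)
        \<le> weight_score w (e ` N) (h ` M) (T N A) (R (e ` N) (h ` M) (T N A))"
      using assms inst[OF I] by (simp add: parameterized_by_def)
    then show "weight_score w N M A c \<le> weight_score w N M A (R' N M A)"
      by (simp add: h_R'[OF I, symmetric] score)
  qed
  moreover have "FVR_bound R' s r" if R: "FVR_bound R s r" for s r
    unfolding FVR_bound_def
  proof (intro allI impI)
    fix N M :: "nat set" and A G
    assume I: "approval_instance N M A" and G: "G \<subseteq> N" "r * real (card N) < real (card G)"
      and fl: "\<forall>i\<in>G. flexible s M A i"
    have "e ` G \<subseteq> e ` N" "r * real (card (e ` N)) < real (card (e ` G))"
      using G by (auto simp: card_image inj_on_subset[OF e])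
    moreover have "\<forall>v\<in>e ` G. flexible s (h ` M) (T N A) v"
      using fl G(1) by (auto simp: flexible_def flex subset_iff)
    ultimately have "\<exists>v\<in>e ` G. R (e ` N) (h ` M) (T N A) \<in> T N A v"
      by (intro R[unfolded FVR_bound_def, rule_format, OF inst[OF I]]) auto
    then obtain i where "i \<in> G" "R (e ` N) (h ` M) (T N A) \<in> T N A (e i)"
      by blast
    moreover have "i \<in> N" using \<open>i \<in> G\<close> G(1) by blast
    ultimately have "R' N M A \<in> A i"
      using h by (simp add: h_R'[OF I, symmetric] T_e inj_image_mem_iff)
    then show "\<exists>i\<in>G. R' N M A \<in> A i"
      using \<open>i \<in> G\<close> by blast
  qed
  ultimately show ?thesis using that by blast
qed

text \<open>Candidate \<open>k\<close> is the favoured one: \<open>k * b\<close> voters approve it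
  and the \<open>k * a\<close> voters in \<open>G\<close> reject it. The hypothesis
  \<open>wins\<close> says exactly that it outscores every other candidate, so \<open>G\<close> is
  unrepresented and the FVR bound caps its size.\<close>

lemma two_group_instance_bound:
  fixes R :: "(nat, nat) rule" and k p q a b :: nat and f g :: rat
  assumes R: "parameterized_by R w"
    and k: "0 < p" "p \<le> k" "0 < q" "q \<le> k"
    and f: "f = of_nat p / of_nat (k + 1)" and g: "g = of_nat q / of_nat (k + 1)"
    and bound: "FVR_bound R (real_of_rat f) (1 - real_of_rat f)"
    and wins: "real a * (real p * w f) < real b * ((real k + 1 - real q) * w g)"
  shows "real a \<le> (1 - real_of_rat f) * (real a + real b)"
proof -
  \<comment> \<open>Group sizes divisible by \<open>k\<close> make each group run through whole
    periods of the cyclic pattern, so all candidates below \<open>k\<close> tie.\<close>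
  define n where "n = k * a + k * b"
  define N where "N = {..<n}"
  define M where "M = {..k}"
  define G where "G = {..<k * a}"
  \<comment> \<open>Outside \<open>G\<close> the cyclic part has only \<open>q - 1\<close>
    candidates, since candidate \<open>k\<close> takes one of the \<open>q\<close>
    approvals.\<close>
  define A where "A = (\<lambda>i\<in>N. if i < k * a then {c \<in> {0..<k}. (i + c) mod k < p}
      else insert k {c \<in> {0..<k}. (i + c) mod k < q - 1})"
  have "0 < a \<or> 0 < b"
    using wins by (intro disjCI) (auto intro: gr0I)
  then have "0 < n" using k by (auto simp: n_def)
  have A_sub: "A i \<subseteq> M" if "i \<in> N" for i
    using that by (auto simp: A_def M_def)
  have inst: "approval_instance N M A"
    unfolding approval_instance_def using \<open>0 < n\<close> A_sub by (auto simp: N_def M_def A_def)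
  have GN: "G \<subseteq> N" by (auto simp: G_def N_def n_def)
  have A_G: "A i = {c \<in> {0..<k}. (i + c) mod k < p}" if "i \<in> G" for i
    using that GN by (auto simp: A_def G_def)
  have A_H: "A i = insert k {c \<in> {0..<k}. (i + c) mod k < q - 1}" if "i \<in> N - G" for i
    using that by (auto simp: A_def G_def)
  have flex_G: "flexibility M A i = f" if "i \<in> G" for i
    using card_shifted_windows_mod_less[of p k 0 1 i] k that
    by (simp add: flexibility_def A_G f M_def)
  have flex_H: "flexibility M A i = g" if "i \<in> N - G" for i
    using card_shifted_windows_mod_less[of "q - 1" k 0 1 i] k that
    by (simp add: flexibility_def A_H g M_def)
  have score: "weight_score w N M A c =
      real (card (approvers N A c \<inter> G)) * w f + real (card (approvers N A c - G)) * w g" for c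
  proof -
    have "finite (approvers N A c)" by (simp add: approvers_def N_def)
    then have "weight_score w N M A c =
        (\<Sum>i\<in>approvers N A c \<inter> G. w (flexibility M A i)) + (\<Sum>i\<in>approvers N A c - G. w (flexibility M A i))"
      unfolding weight_score_def by (rule sum.Int_Diff)
    also have "(\<Sum>i\<in>approvers N A c \<inter> G. w (flexibility M A i)) = (\<Sum>i\<in>approvers N A c \<inter> G. w f)"
      by (rule sum.cong) (auto simp: flex_G)
    also have "(\<Sum>i\<in>approvers N A c - G. w (flexibility M A i)) = (\<Sum>i\<in>approvers N A c - G. w g)"
      by (rule sum.cong) (auto simp: flex_H approvers_def)
    finally show ?thesis by simp
  qed
  have NG: "N - G = {k * a..<k * a + k * b}"
    by (auto simp: N_def G_def n_def)
  have "approvers N A k \<inter> G = {}" "approvers N A k - G = N - G"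
    by (auto simp: approvers_def A_G A_H)
  then have score_k: "weight_score w N M A k = real (k * b) * w g"
    by (simp add: score NG)
  have score_less: "weight_score w N M A c = real (a * p) * w f + real (b * (q - 1)) * w g"
    if "c < k" for c
  proof -
    have "approvers N A c \<inter> G = {i \<in> {0..<0 + k * a}. (c + i) mod k < p}"
      using that GN A_G by (auto simp: approvers_def G_def add.commute)
    moreover have "approvers N A c - G = {i \<in> N - G. (c + i) mod k < q - 1}"
      using that by (auto simp: approvers_def A_H add.commute)
    ultimately show ?thesis
      using k card_shifted_windows_mod_less[of p k 0 a c]
        card_shifted_windows_mod_less[of "q - 1" k "k * a" b c]
      by (simp add: score NG)
  qed
  \<comment> \<open>The score lead of \<open>k\<close> over any other candidate is
    \<open>b * (k - (q - 1)) * w g - a * p * w f\<close>, positive by \<open>wins\<close>.\<close>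
  have "R N M A = k"
  proof (rule ccontr)
    assume "R N M A \<noteq> k"
    moreover have "R N M A \<in> M"
      and le: "weight_score w N M A k \<le> weight_score w N M A (R N M A)"
      using R inst by (auto simp: parameterized_by_def single_winner_rule_def M_def)
    ultimately have "R N M A < k" by (simp add: M_def)
    then show False
      using le wins k by (simp add: score_k score_less of_nat_diff algebra_simps)
  qed
  then have "\<not> (\<exists>i\<in>G. R N M A \<in> A i)"
    by (auto simp: A_G)
  moreover have "\<forall>i\<in>G. flexible (real_of_rat f) M A i"
    by (simp add: flexible_def flex_G)
  ultimately have "\<not> (1 - real_of_rat f) * real (card N) < real (card G)"
    using bound inst GN unfolding FVR_bound_def by blast
  then have "real k * real a \<le> real k * ((1 - real_of_rat f) * (real a + real b))"
    by (simp add: N_def G_def n_def algebra_simps)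
  then show ?thesis using k by simp
qed

lemma scaled_weight_le:
  fixes R :: "(nat, nat) rule" and f g :: rat
  assumes R: "parameterized_by R w"
    and bound: "FVR_bound R (real_of_rat f) (1 - real_of_rat f)"
    and f: "f \<in> {0<..<1}" and g: "g \<in> {0<..<1}"
  shows "(1 - real_of_rat g) * w g \<le> (1 - real_of_rat f) * w f"
proof (rule ccontr)
  obtain p1 m1 where fr1: "f = of_int p1 / of_int m1" "m1 > 0"
    by (metis quotient_of_denom_pos quotient_of_div surj_pair)
  obtain p2 m2 where fr2: "g = of_int p2 / of_int m2" "m2 > 0"
    by (metis quotient_of_denom_pos quotient_of_div surj_pair)
  have p: "0 < p1" "p1 < m1" "0 < p2" "p2 < m2"
    using f g fr1 fr2 by (auto simp: field_simps)
  \<comment> \<open>With the common denominator \<open>m1 * m2 = k + 1\<close>, both flexibilities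
    are realized over the same \<open>k + 1\<close> candidates.\<close>
  define k where "k = nat (m1 * m2 - 1)"
  define p' where "p' = nat (p1 * m2)"
  define q where "q = nat (p2 * m1)"
  have pos: "0 < p1 * m2" "p1 * m2 < m1 * m2" "0 < p2 * m1" "p2 * m1 < m1 * m2"
    using p fr1 fr2 by (auto simp: mult.commute)
  have k: "0 < p'" "p' \<le> k" "0 < q" "q \<le> k"
    using pos by (auto simp: p'_def q_def k_def)
  have f_eq: "f = of_nat p' / of_nat (k + 1)" and g_eq: "g = of_nat q / of_nat (k + 1)"
    using pos fr1 fr2 by (simp_all add: p'_def q_def k_def of_nat_nat)
  define F where "F = real_of_rat f"
  have F_eq: "real p' = F * (real k + 1)" and G_eq: "real q = real_of_rat g * (real k + 1)"
    by (simp_all add: F_def f_eq g_eq of_rat_divide of_rat_add field_simps)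
  assume "\<not> (1 - real_of_rat g) * w g \<le> (1 - real_of_rat f) * w f"
  then have "0 < (1 - real_of_rat g) * w g - (1 - F) * w f" (is "0 < ?d")
    by (simp add: F_def)
  \<comment> \<open>The gap \<open>?d\<close>, amplified by \<open>L\<close>, must absorb the term
    \<open>F * w f\<close> contributed by the one extra unit in \<open>a\<close> below.\<close>
  then obtain L :: nat where L: "F * w f < real L * (real p' * ?d)"
    using k reals_Archimedean3[of "real p' * ?d"] by auto
  \<comment> \<open>The share \<open>a / (a + b)\<close> exceeds \<open>1 - f\<close> and tends to it as \<open>L\<close> grows.\<close>
  define a where "a = (k + 1 - p') * L + 1"
  define b where "b = p' * L"
  have "real (k + 1 - p') = (1 - F) * (real k + 1)"
    using k F_eq by (simp add: of_nat_diff algebra_simps)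
  then have a_eq: "real a = (1 - F) * (real k + 1) * real L + 1"
    by (simp add: a_def)
  have b_eq: "real b = F * (real k + 1) * real L"
    using F_eq by (simp add: b_def)
  have "real a * (F * w f) < real b * ((1 - real_of_rat g) * w g)"
    using L unfolding a_eq b_eq F_eq by (simp add: algebra_simps)
  \<comment> \<open>Scaling by the number of candidates turns the flexibilities into the numerators
    \<open>p'\<close> and \<open>q\<close>.\<close>
  then have "(real k + 1) * (real a * (F * w f)) < (real k + 1) * (real b * ((1 - real_of_rat g) * w g))"
    by (intro mult_strict_left_mono) auto
  then have "real a * (real p' * w f) < real b * ((real k + 1 - real q) * w g)"
    unfolding F_eq G_eq by (simp add: algebra_simps)
  then have "real a \<le> (1 - F) * (real a + real b)"
    using two_group_instance_bound[OF R k f_eq g_eq bound] by (simp add: F_def)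
  \<comment> \<open>The terms in \<open>L\<close> cancel, as \<open>a + b = (k + 1) * L + 1\<close>;
    what remains is \<open>1 \<le> 1 - F\<close>, due to the extra unit in \<open>a\<close>.\<close>
  then have "F \<le> 0"
    unfolding a_eq b_eq by (simp add: algebra_simps)
  then show False using f by (simp add: F_def)
qed

theorem theorem2p7:
  fixes w :: "rat \<Rightarrow> real" and R :: "('v::infinite, 'c::infinite) rule"
  assumes "weight_function w" and "nontrivial_weight w"
    and "parameterized_by R w"
    and "FVR_optimal R"
  shows "\<exists>c::real. c > 0 \<and> (\<forall>f\<in>{0<..<1}. w f = c / (1 - real_of_rat f))"
proof -
  obtain R' :: "(nat, nat) rule" where R': "parameterized_by R' w"
    and trans: "\<And>s r. FVR_bound R s r \<Longrightarrow> FVR_bound R' s r"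
    using rule_transport_nat[OF assms(3)] by blast
  have bound: "FVR_bound R' (real_of_rat f) (1 - real_of_rat f)" if "f \<in> {0<..<1}" for f
  proof -
    have "FVR R (real_of_rat f) = 1 - real_of_rat f"
      using assms(4) that by (simp add: FVR_optimal_def)
    then show ?thesis
      using FVR_is_minimum(2)[of R "real_of_rat f"] trans by simp
  qed
  obtain f0 where f0: "f0 \<in> {0<..<1}" "w f0 > 0"
    using assms(2) by (auto simp: nontrivial_weight_def)
  define c where "c = (1 - real_of_rat f0) * w f0"
  have "w f = c / (1 - real_of_rat f)" if f: "f \<in> {0<..<1}" for f
  proof -
    \<comment> \<open>The inequality is used in both directions between \<open>f\<close> and the
      reference point \<open>f0\<close>.\<close>
    have "(1 - real_of_rat f) * w f = c"
      unfolding c_def using scaled_weight_le[OF R' bound] f f0(1) by (intro antisym) auto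
    moreover have "real_of_rat f < 1" using f by simp
    ultimately show ?thesis by (simp add: field_simps)
  qed
  moreover have "c > 0" using f0 by (simp add: c_def)
  ultimately show ?thesis by blast
qed

end
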